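(* Let $\Gamma$ be a sequent and $\mathcal{T}$ be a TBox with associated concept assertion $T \geq 1$. If there exists an open tableau $G$ for $\Gamma$ and $T \geq 1$, then $\Gamma$ is $\mathcal T$-satisfiable.
   Context: Non-expansive fuzzy $\mathcal{ALC}$: over atomic concepts $\mathsf{N_C}$ and role names $\mathsf{N_R}$, concepts are $C,D ::= p \mid c \mid \lnot C \mid C \ominus c \mid C \sqcap D \mid \exists R.C$ ($c$ a rational constant in $[0,1]$). An interpretation $\mathcal{I}$ has nonempty domain $\Delta^\mathcal{I}$, $p^\mathcal{I}:\Delta^\mathcal{I}\to[0,1]$, $R^\mathcal{I}:\Delta^\mathcal{I}\times\Delta^\mathcal{I}\to[0,1]$, with $c^\mathcal{I}(x)=c$, $(\lnot D)^\mathcal{I}(x)=1-D^\mathcal{I}(x)$, $(C\ominus c)^\mathcal{I}(x)=\max(C^\mathcal{I}(x)-c,0)$, $(C\sqcap D)^\mathcal{I}(x)=\min$, $(\exists R.C)^\mathcal{I}(x)=\sup_y\min(R^\mathcal{I}(x,y),C^\mathcal{I}(y))$; $C\sqcup D=\lnot(\lnot C\sqcap\lnot D)$, $C\oplus c=\lnot((\lnot C)\ominus c)$. Concept assertions $C\bowtie c$, ${\bowtie}\in\{<,\le,>,\ge\}$; a sequent is a finite set of them. A TBox is a set of GCIs $C\sqsubseteq D$, satisfied by $\mathcal{I}$ if $C^\mathcal{I}(x)\le D^\mathcal{I}(x)$ for all $x$; $\Gamma$ is $\mathcal{T}$-satisfiable if some $\mathcal{I}$ satisfying $\mathcal{T}$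 has an individual satisfying all assertions of $\Gamma$. Associated concept assertion of $\mathcal{T}=\{C_i\sqsubseteq D_i\}_{i=1}^n$ and $\Gamma$: $Z=[0,1]\cap$ (additive subgroup of $\mathbb{Q}$ generated by $1$ and the constants in $\Gamma,\mathcal{T}$), $\epsilon=\frac12\min(Z\setminus\{0\})$, $Z'=Z\cup\{z+\epsilon\mid z\in Z\setminus\{1\}\}$, and $T=T_1\sqcap\cdots\sqcap T_n$ with $T_i=\bigsqcup_{z\in Z'}((\lnot C_i\oplus z)\sqcap(D_i\oplus(1-z)))$. Tableau rules (with ${\triangleleft}\in\{<,\le\}$, ${\triangleright}\in\{>,\ge\}$; ${\bowtie^\circ}$ reverses direction: $>\leftrightarrow<$, $\ge\leftrightarrow\le$; for a pair $(\triangleleft,\triangleright)$ let $\blacktriangleleft$ be $<$ if $(\triangleleft,\triangleright)=(\le,\ge)$ and $\le$ otherwise): (Ax 1) $S,p\triangleright c\,/\,\bot$ if no value in $[0,1]$ satisfies $p\triangleright c$ (i.e. $c\ge1$ for $>$, $c>1$ for $\ge$), $p\in\mathsf{N_C}$; (Ax 0) $S,p\triangleleft c\,/\,\bot$ if $c\le 0$ for $<$, $c<0$ for $\le$; (Ax c) $S,c\triangleleft d\,/\,\bot$ for constants $c,d$ if $c\triangleleft d$ is false; (Ax p) $S,p\triangleleft c,p\triangleright d\,/\,\bot$ if $d\blacktriangleleft c$; ($\sqcap\triangleright$) $S,C\sqcap D\triangleright c\,/\,S,C\triangleright c,D\triangleright c$; ($\sqcap\triangleleft$) $S,C\sqcap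 D\triangleleft c\,/\,S,C\triangleleft c \mid S,D\triangleleft c$ (two conclusions); ($\lnot\bowtie$) $S,\lnot C\bowtie c\,/\,S,C\bowtie^\circ 1-c$; ($\ominus\triangleleft$) $S,C\ominus c\triangleleft d\,/\,S,C\triangleleft d+c,\ d\triangleleft^\circ 0$; ($\ominus\triangleright$) $S,C\ominus c\triangleright d\,/\,S,C\triangleright d+c$ provided $d\ge0$ for $>$ and $d>0$ for $\ge$; ($\exists R$) $S,\{\exists R.D_j\triangleleft_j d_j\mid 1\le j\le n\},\exists R.C\triangleright c\,/\,\{D_j\triangleleft_j d_j\mid d_j\blacktriangleleft_{(\triangleleft_j,\triangleright)}c\},C\triangleright c,T\ge1$, provided $c\ge0$ for $>$ resp. $c>0$ for $\ge$, and $S$ contains no assertion $\exists R.D\triangleleft d$. All rules except ($\exists R$) are propositional; a sequent is saturated if no propositional rule applies. A tableau graph has a directed graph $(V^G,E^G)$, a root $r^G$, and labels $\mathcal{L}^G(v)$ (a set of assertions or $\bot$); a node is an AND-node if its label is saturated, otherwise an OR-node. $G$ is a tableau for $\Gamma$ and $T\ge1$ if the root label is $\Gamma\cup\{T\ge1\}$, at each OR-node the children's labels are exactly the conclusions of one propositional rule instance applied to its label, and at each AND-node the children's labels are exactly the conclusions of all possible ($\exists R$) applications. A marking is a full subgraph containing the root, containing all children of its AND-nodes and at least one child of each of its OR-nodes; it is consistent if it has no node labelled $\bot$; $G$ is open if a consistent marking exists.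
   Formalization: As listed, the rules make the claim false (e.g. {p ≤ 1/5, p ≥ 4/5}, {p⊖1/2 < 0}, {∃R.p < 0} stay open); here (Ax p) closes when c ◀ d, (Ax c) covers all four comparisons, (Ax 0) also covers ∃R.C ◁ c, and a rule's principal assertion is consumed. *)

theory Defs
  imports Complex_Main "HOL-Computational_Algebra.Group_Closure"
begin

datatype ('p, 'r) concept =
    Atom 'p
  | Const rat
  | Neg "('p, 'r) concept"
  | Ominus "('p, 'r) concept" rat
  | Conj "('p, 'r) concept" "('p, 'r) concept"
  | ExR 'r "('p, 'r) concept"

abbreviation Disj :: "('p, 'r) concept \<Rightarrow> ('p, 'r) concept \<Rightarrow> ('p, 'r) concept" where
  "Disj C D \<equiv> Neg (Conj (Neg C) (Neg D))"

abbreviation Oplus :: "('p, 'r) concept \<Rightarrow> rat \<Rightarrow> ('p, 'r) concept" where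
  "Oplus C c \<equiv> Neg (Ominus (Neg C) c)"

primrec concept_consts :: "('p, 'r) concept \<Rightarrow> rat set" where
  "concept_consts (Atom p) = {}"
| "concept_consts (Const c) = {c}"
| "concept_consts (Neg C) = concept_consts C"
| "concept_consts (Ominus C c) = insert c (concept_consts C)"
| "concept_consts (Conj C D) = concept_consts C \<union> concept_consts D"
| "concept_consts (ExR R C) = concept_consts C"

(* The grammar only admits constants from the unit interval. This is a predicate instead of
   being built into the type because the rule for C \<ominus> c \<triangleleft> d produces an assertion
   whose concept is the constant d, and d may have left the unit interval. *)
definition wf_concept :: "('p, 'r) concept \<Rightarrow> bool" where
  "wf_concept C \<longleftrightarrow> concept_consts C \<subseteq> {0..1}"

record ('i, 'p, 'r) interp =
  indivs :: "'i set"
  atom_val :: "'p \<Rightarrow> 'i \<Rightarrow> real"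
  role_val :: "'r \<Rightarrow> 'i \<Rightarrow> 'i \<Rightarrow> real"

definition interpretation_ok :: "('i, 'p, 'r) interp \<Rightarrow> bool" where
  "interpretation_ok I \<longleftrightarrow>
     indivs I \<noteq> {} \<and>
     (\<forall>p. \<forall>x \<in> indivs I. atom_val I p x \<in> {0..1}) \<and>
     (\<forall>R. \<forall>x \<in> indivs I. \<forall>y \<in> indivs I. role_val I R x y \<in> {0..1})"

primrec ceval :: "('i, 'p, 'r) interp \<Rightarrow> ('p, 'r) concept \<Rightarrow> 'i \<Rightarrow> real" where
  "ceval I (Atom p) x = atom_val I p x"
| "ceval I (Const c) x = of_rat c"
| "ceval I (Neg C) x = 1 - ceval I C x"
| "ceval I (Ominus C c) x = max (ceval I C x - of_rat c) 0"
| "ceval I (Conj C D) x = min (ceval I C x) (ceval I D x)"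
| "ceval I (ExR R C) x = (SUP y \<in> indivs I. min (role_val I R x y) (ceval I C y))"

datatype cmp = Lt | Le | Gt | Ge

primrec holds :: "cmp \<Rightarrow> 'a::ord \<Rightarrow> 'a \<Rightarrow> bool" where
  "holds Lt a b \<longleftrightarrow> a < b"
| "holds Le a b \<longleftrightarrow> a \<le> b"
| "holds Gt a b \<longleftrightarrow> a > b"
| "holds Ge a b \<longleftrightarrow> a \<ge> b"

abbreviation uppers :: "cmp set" where "uppers \<equiv> {Lt, Le}"
abbreviation lowers :: "cmp set" where "lowers \<equiv> {Gt, Ge}"

primrec rev_cmp :: "cmp \<Rightarrow> cmp" where
  "rev_cmp Lt = Gt"
| "rev_cmp Le = Ge"
| "rev_cmp Gt = Lt"
| "rev_cmp Ge = Le"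

(* clash u l a b is a \<blacktriangleleft> b for the pair (u, l): the bounds "u a" from above and
   "l b" from below exclude each other. *)
definition clash :: "cmp \<Rightarrow> cmp \<Rightarrow> rat \<Rightarrow> rat \<Rightarrow> bool" where
  "clash u l a b \<longleftrightarrow> (if (u, l) = (Le, Ge) then a < b else a \<le> b)"

definition nontrivial_lower :: "cmp \<Rightarrow> rat \<Rightarrow> bool" where
  "nontrivial_lower l c \<longleftrightarrow> (l = Gt \<and> c \<ge> 0) \<or> (l = Ge \<and> c > 0)"

(* The bound of an assertion ranges over all rationals: the rules leave the unit interval. *)
type_synonym ('p, 'r) assertion = "('p, 'r) concept \<times> cmp \<times> rat"

definition sequent :: "('p, 'r) assertion set \<Rightarrow> bool" where
  "sequent \<Gamma> \<longleftrightarrow> finite \<Gamma> \<and> (\<forall>(C, b, c) \<in> \<Gamma>. wf_concept C)"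

fun sat_assertion :: "('i, 'p, 'r) interp \<Rightarrow> 'i \<Rightarrow> ('p, 'r) assertion \<Rightarrow> bool" where
  "sat_assertion I x (C, b, c) \<longleftrightarrow> holds b (ceval I C x) (of_rat c)"

(* The pair (C, D) stands for the inclusion C \<sqsubseteq> D. *)
type_synonym ('p, 'r) gci = "('p, 'r) concept \<times> ('p, 'r) concept"

definition tbox :: "('p, 'r) gci set \<Rightarrow> bool" where
  "tbox TB \<longleftrightarrow> finite TB \<and> (\<forall>(C, D) \<in> TB. wf_concept C \<and> wf_concept D)"

definition sat_tbox :: "('i, 'p, 'r) interp \<Rightarrow> ('p, 'r) gci set \<Rightarrow> bool" where
  "sat_tbox I TB \<longleftrightarrow> (\<forall>(C, D) \<in> TB. \<forall>x \<in> indivs I. ceval I C x \<le> ceval I D x)"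

(* HOL cannot quantify over the type of individuals inside a formula, so it is a parameter;
   domains are arbitrary nonempty subsets of it. *)
definition satisfiable :: "'i itself \<Rightarrow> ('p, 'r) gci set \<Rightarrow> ('p, 'r) assertion set \<Rightarrow> bool" where
  "satisfiable _ TB \<Gamma> \<longleftrightarrow>
     (\<exists>I :: ('i, 'p, 'r) interp. interpretation_ok I \<and> sat_tbox I TB \<and>
        (\<exists>x \<in> indivs I. \<forall>A \<in> \<Gamma>. sat_assertion I x A))"

definition all_consts :: "('p, 'r) gci set \<Rightarrow> ('p, 'r) assertion set \<Rightarrow> rat set" where
  "all_consts TB \<Gamma> =
     (\<Union>(C, b, c) \<in> \<Gamma>. insert c (concept_consts C)) \<union>
     (\<Union>(C, D) \<in> TB. concept_consts C \<union> concept_consts D)"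

definition Zset :: "('p, 'r) gci set \<Rightarrow> ('p, 'r) assertion set \<Rightarrow> rat set" where
  "Zset TB \<Gamma> = {0..1} \<inter> group_closure (insert 1 (all_consts TB \<Gamma>))"

definition Zeps :: "('p, 'r) gci set \<Rightarrow> ('p, 'r) assertion set \<Rightarrow> rat" where
  "Zeps TB \<Gamma> = Min (Zset TB \<Gamma> - {0}) / 2"

definition Zset' :: "('p, 'r) gci set \<Rightarrow> ('p, 'r) assertion set \<Rightarrow> rat set" where
  "Zset' TB \<Gamma> = Zset TB \<Gamma> \<union> (\<lambda>z. z + Zeps TB \<Gamma>) ` (Zset TB \<Gamma> - {1})"

(* Empty conjunctions (for the empty TBox) and disjunctions are the constants 1 and 0. *)
fun big_conj :: "('p, 'r) concept list \<Rightarrow> ('p, 'r) concept" where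
  "big_conj [] = Const 1"
| "big_conj [C] = C"
| "big_conj (C # D # Cs) = Conj C (big_conj (D # Cs))"

fun big_disj :: "('p, 'r) concept list \<Rightarrow> ('p, 'r) concept" where
  "big_disj [] = Const 0"
| "big_disj [C] = C"
| "big_disj (C # D # Cs) = Disj C (big_disj (D # Cs))"

definition gci_concept :: "rat list \<Rightarrow> ('p, 'r) gci \<Rightarrow> ('p, 'r) concept" where
  "gci_concept zs g =
     big_disj (map (\<lambda>z. Conj (Oplus (Neg (fst g)) z) (Oplus (snd g) (1 - z))) zs)"

(* T is determined only up to the order in which the TBox and Z' are listed. *)
definition assoc_concept ::
    "('p, 'r) gci set \<Rightarrow> ('p, 'r) assertion set \<Rightarrow> ('p, 'r) concept \<Rightarrow> bool" where
  "assoc_concept TB \<Gamma> T \<longleftrightarrow>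
     (\<exists>gs zs. distinct gs \<and> set gs = TB \<and> distinct zs \<and> set zs = Zset' TB \<Gamma> \<and>
        T = big_conj (map (gci_concept zs) gs))"

lemma finite_concept_consts: "finite (concept_consts C)"
  by (induction C) auto

lemma common_denominator:
  assumes "finite (S :: rat set)"
  shows "\<exists>N > 0. \<forall>s \<in> S. \<exists>k :: int. s = of_int k / of_int N"
  using assms
proof (induction S rule: finite_induct)
  case empty
  show ?case by (auto intro: exI[of _ 1])
next
  case (insert x S)
  then obtain N :: int where N: "N > 0" "\<forall>s \<in> S. \<exists>k :: int. s = of_int k / of_int N"
    by auto
  obtain a b :: int where ab: "b > 0" "x = of_int a / of_int b"
    by (metis quotient_of_denom_pos' quotient_of_div surjective_pairing)
  have "\<exists>k :: int. s = of_int k / of_int (N * b)" if s: "s \<in> insert x S" for s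
  proof (cases "s = x")
    case True
    then have "s = of_int (a * N) / of_int (N * b)" using ab N by simp
    then show ?thesis by blast
  next
    case False
    then obtain k where "s = of_int k / of_int N" using N s by auto
    then have "s = of_int (k * b) / of_int (N * b)" using ab by simp
    then show ?thesis by blast
  qed
  moreover have "N * b > 0" using N ab by simp
  ultimately show ?case by blast
qed

lemma finite_unit_group_closure:
  assumes "finite (S :: rat set)"
  shows "finite ({0..1} \<inter> group_closure S)"
proof -
  obtain N :: int where N: "N > 0" "\<forall>s \<in> S. \<exists>k :: int. s = of_int k / of_int N"
    using common_denominator[OF assms] by blast
  have closure: "\<exists>k :: int. x = of_int k / of_int N" if "x \<in> group_closure S" for x
    using that
  proof induction
    case (base s)
    then show ?case using N by (auto intro: exI[of _ 0])
  next
    case (diff s t)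
    then obtain j k where "s = of_int j / of_int N" "t = of_int k / of_int N" by blast
    then have "s - t = of_int (j - k) / of_int N" by (simp add: diff_divide_distrib)
    then show ?case by blast
  qed
  have "{0..1} \<inter> group_closure S \<subseteq> (\<lambda>k. of_int k / of_int N) ` {0..N}"
  proof
    fix x :: rat
    assume x: "x \<in> {0..1} \<inter> group_closure S"
    then obtain k where k: "x = of_int k / of_int N" using closure by blast
    with x N have "k \<in> {0..N}" by (auto simp: field_simps)
    with k show "x \<in> (\<lambda>k. of_int k / of_int N) ` {0..N}" by blast
  qed
  then show ?thesis using finite_subset by blast
qed

lemma finite_Zset:
  assumes "sequent \<Gamma>" and "tbox TB"
  shows "finite (Zset TB \<Gamma>)"
  unfolding Zset_def using assms
  by (intro finite_unit_group_closure)
     (auto simp: all_consts_def sequent_def tbox_def finite_concept_consts)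

lemma assoc_concept_exists:
  assumes "sequent \<Gamma>" and "tbox TB"
  shows "\<exists>T. assoc_concept TB \<Gamma> T"
proof -
  have "finite (Zset' TB \<Gamma>)" using finite_Zset[OF assms] by (simp add: Zset'_def)
  then obtain zs where "set zs = Zset' TB \<Gamma>" "distinct zs" using finite_distinct_list by blast
  moreover obtain gs where "set gs = TB" "distinct gs"
    using assms finite_distinct_list by (auto simp: tbox_def)
  ultimately show ?thesis
    unfolding assoc_concept_def by blast
qed

datatype ('p, 'r) label = Bot | Seq "('p, 'r) assertion set"

(* prop_rule P Q: a propositional rule instance with premise P and set of conclusions Q.
   In "S, A" the principal assertion A is not a member of S, so it is consumed by the rule;
   otherwise a tableau could loop on the same propositional rule forever.
   Ax_p closes exactly the contradictory pairs: upper bound c \<blacktriangleleft> lower bound d.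
   Ax_c is needed for all four comparisons (the rule for C \<ominus> c \<triangleleft> d creates lower
   bounds on constants), and since no propositional rule decomposes \<exists>R.C \<triangleleft> c, its
   unsatisfiable instances have to be closed like those of p \<triangleleft> c, by Ax_0_ex. *)
inductive prop_rule :: "('p, 'r) assertion set \<Rightarrow> ('p, 'r) label set \<Rightarrow> bool" where
  Ax_1: "(l = Gt \<and> c \<ge> 1) \<or> (l = Ge \<and> c > 1) \<Longrightarrow>
    prop_rule (insert (Atom p, l, c) S) {Bot}"
| Ax_0: "(u = Lt \<and> c \<le> 0) \<or> (u = Le \<and> c < 0) \<Longrightarrow>
    prop_rule (insert (Atom p, u, c) S) {Bot}"
| Ax_0_ex: "(u = Lt \<and> c \<le> 0) \<or> (u = Le \<and> c < 0) \<Longrightarrow>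
    prop_rule (insert (ExR R C, u, c) S) {Bot}"
| Ax_c: "\<not> holds b c d \<Longrightarrow>
    prop_rule (insert (Const c, b, d) S) {Bot}"
| Ax_p: "u \<in> uppers \<Longrightarrow> l \<in> lowers \<Longrightarrow> clash u l c d \<Longrightarrow>
    prop_rule (insert (Atom p, u, c) (insert (Atom p, l, d) S)) {Bot}"
| Conj_lower: "l \<in> lowers \<Longrightarrow> (Conj C D, l, c) \<notin> S \<Longrightarrow>
    prop_rule (insert (Conj C D, l, c) S) {Seq (S \<union> {(C, l, c), (D, l, c)})}"
| Conj_upper: "u \<in> uppers \<Longrightarrow> (Conj C D, u, c) \<notin> S \<Longrightarrow>
    prop_rule (insert (Conj C D, u, c) S) {Seq (S \<union> {(C, u, c)}), Seq (S \<union> {(D, u, c)})}"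
| Neg_cmp: "(Neg C, b, c) \<notin> S \<Longrightarrow>
    prop_rule (insert (Neg C, b, c) S) {Seq (S \<union> {(C, rev_cmp b, 1 - c)})}"
| Ominus_upper: "u \<in> uppers \<Longrightarrow> (Ominus C c, u, d) \<notin> S \<Longrightarrow>
    prop_rule (insert (Ominus C c, u, d) S)
      {Seq (S \<union> {(C, u, d + c), (Const d, rev_cmp u, 0)})}"
| Ominus_lower: "l \<in> lowers \<Longrightarrow> nontrivial_lower l d \<Longrightarrow> (Ominus C c, l, d) \<notin> S \<Longrightarrow>
    prop_rule (insert (Ominus C c, l, d) S) {Seq (S \<union> {(C, l, d + c)})}"

(* The side condition that S contains no \<exists>R.D \<triangleleft> d forces the displayed family to
   consist of all assertions of this form in the premise. *)
inductive ex_rule ::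
    "('p, 'r) concept \<Rightarrow> ('p, 'r) assertion set \<Rightarrow> ('p, 'r) assertion set \<Rightarrow> bool" for T where
  "(ExR R C, l, c) \<in> P \<Longrightarrow> l \<in> lowers \<Longrightarrow> nontrivial_lower l c \<Longrightarrow>
    ex_rule T P ({(D, u, d) | D u d. (ExR R D, u, d) \<in> P \<and> u \<in> uppers \<and> clash u l d c}
                 \<union> {(C, l, c), (T, Ge, 1)})"

(* No rule applies to Bot, hence it is saturated. *)
definition saturated :: "('p, 'r) label \<Rightarrow> bool" where
  "saturated L \<longleftrightarrow> \<not> (\<exists>P Q. L = Seq P \<and> prop_rule P Q)"

record ('v, 'p, 'r) tableau_graph =
  verts :: "'v set"
  edges :: "('v \<times> 'v) set"
  root_node :: 'v
  lab :: "'v \<Rightarrow> ('p, 'r) label"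

definition children :: "('v, 'p, 'r) tableau_graph \<Rightarrow> 'v \<Rightarrow> 'v set" where
  "children G v = {w. (v, w) \<in> edges G}"

definition and_node :: "('v, 'p, 'r) tableau_graph \<Rightarrow> 'v \<Rightarrow> bool" where
  "and_node G v \<longleftrightarrow> saturated (lab G v)"

abbreviation or_node :: "('v, 'p, 'r) tableau_graph \<Rightarrow> 'v \<Rightarrow> bool" where
  "or_node G v \<equiv> \<not> and_node G v"

definition tableau ::
    "('v, 'p, 'r) tableau_graph \<Rightarrow> ('p, 'r) assertion set \<Rightarrow> ('p, 'r) concept \<Rightarrow> bool" where
  "tableau G \<Gamma> T \<longleftrightarrow>
     root_node G \<in> verts G \<and> edges G \<subseteq> verts G \<times> verts G \<and>
     lab G (root_node G) = Seq (\<Gamma> \<union> {(T, Ge, 1)}) \<and>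
     (\<forall>v \<in> verts G. or_node G v \<longrightarrow>
        (\<exists>P Q. lab G v = Seq P \<and> prop_rule P Q \<and> lab G ` children G v = Q)) \<and>
     (\<forall>v \<in> verts G. and_node G v \<longrightarrow>
        lab G ` children G v = {Seq Q | P Q. lab G v = Seq P \<and> ex_rule T P Q})"

(* A full subgraph is given by its set of vertices. *)
definition marking :: "('v, 'p, 'r) tableau_graph \<Rightarrow> 'v set \<Rightarrow> bool" where
  "marking G M \<longleftrightarrow>
     M \<subseteq> verts G \<and> root_node G \<in> M \<and>
     (\<forall>v \<in> M. and_node G v \<longrightarrow> children G v \<subseteq> M) \<and>
     (\<forall>v \<in> M. or_node G v \<longrightarrow> children G v \<inter> M \<noteq> {})"

definition consistent_marking :: "('v, 'p, 'r) tableau_graph \<Rightarrow> 'v set \<Rightarrow> bool" where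
  "consistent_marking G M \<longleftrightarrow> marking G M \<and> (\<forall>v \<in> M. lab G v \<noteq> Bot)"

definition open_tableau :: "('v, 'p, 'r) tableau_graph \<Rightarrow> bool" where
  "open_tableau G \<longleftrightarrow> (\<exists>M. consistent_marking G M)"

end

theory Submission
  imports Defs "HOL-Library.Countable_Set"
begin

text \<open>
  A propositional rule replaces an assertion by assertions on smaller concepts, so from every
  node of a consistent marking a path of chosen children ends at a saturated label, and the
  union of the labels on that path is a finite Hintikka set. Each application of the existential
  rule to such a set is realised by another one, and closing off from the root gives countably
  many, which become the individuals. Since clash describes exactly the contradictory pairs of
  bounds and the sets are finite, atoms and role edges can be given values in the unit interval
  that meet all their bounds. For the role edge of an assertion $\exists R.C \triangleright c$
  these are $\triangleright c$ and the bounds $\triangleleft d$ of all those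
  $\exists R.D \triangleleft d$ whose $D \triangleleft d$ the existential rule does not hand
  on to the successor. Finally, $T \geq 1$ holds at every individual, and $T_i \geq 1$ yields
  some $z$ with $C_i \leq z \leq D_i$.
\<close>

section \<open>Bounds\<close>

definition consistent_bounds :: "(cmp \<times> rat) set \<Rightarrow> bool" where
  "consistent_bounds B \<longleftrightarrow>
     (\<forall>u c l d. (u, c) \<in> B \<longrightarrow> (l, d) \<in> B \<longrightarrow> u \<in> uppers \<longrightarrow> l \<in> lowers \<longrightarrow> \<not> clash u l c d)"

definition unit_bounds :: "(cmp \<times> rat) set" where
  "unit_bounds = {(Ge, 0), (Le, 1)}"

text \<open>The midpoint of the greatest lower bound \<open>L\<close> and the least upper bound
  \<open>U\<close> works; \<open>unit_bounds\<close> ensures that both exist. If a strict bound is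
  attained at \<open>L\<close> or \<open>U\<close>, the absence of a clash with the opposite extreme
  gives \<open>L < U\<close>, so the midpoint respects strictness too. All of this happens in the
  rationals and is then embedded into the reals.\<close>

lemma consistent_bounds_solvable:
  assumes "finite B" "consistent_bounds B" "unit_bounds \<subseteq> B"
  shows "\<exists>v :: real. \<forall>(b, c) \<in> B. holds b v (of_rat c)"
proof -
  define Ls where "Ls = {c. \<exists>l \<in> lowers. (l, c) \<in> B}"
  define Us where "Us = {c. \<exists>u \<in> uppers. (u, c) \<in> B}"
  define L where "L = Max Ls"
  define U where "U = Min Us"
  have "Ls \<subseteq> snd ` B" "Us \<subseteq> snd ` B"
    unfolding Ls_def Us_def by force+
  then have fin: "finite Ls" "finite Us"
    using assms(1) finite_subset by blast+
  have ne: "Ls \<noteq> {}" "Us \<noteq> {}"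
    using assms(3) by (auto simp: Ls_def Us_def unit_bounds_def)
  obtain l where l: "l \<in> lowers" "(l, L) \<in> B"
    using Max_in[OF fin(1) ne(1)] unfolding L_def Ls_def by blast
  obtain u where u: "u \<in> uppers" "(u, U) \<in> B"
    using Min_in[OF fin(2) ne(2)] unfolding U_def Us_def by blast
  have noclash: "\<not> clash u' l' c d" if "(u', c) \<in> B" "(l', d) \<in> B" "u' \<in> uppers" "l' \<in> lowers"
    for u' l' c d
    using assms(2) that unfolding consistent_bounds_def by blast
  have LU: "L \<le> U"
    using noclash[OF u(2) l(2) u(1) l(1)] by (auto simp: clash_def split: if_splits)
  have sat: "holds b ((L + U) / 2) c" if bc: "(b, c) \<in> B" for b c
  proof (cases "b \<in> uppers")
    case True
    then have "U \<le> c"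
      using bc fin by (auto simp: U_def Us_def intro!: Min_le)
    moreover have "\<not> clash b l c L"
      using noclash[OF bc l(2) True l(1)] .
    ultimately show ?thesis
      using LU True by (auto simp: clash_def split: if_splits)
  next
    case False
    then have b: "b \<in> lowers" by (cases b) auto
    then have "c \<le> L"
      using bc fin by (auto simp: L_def Ls_def intro!: Max_ge)
    moreover have "\<not> clash u b U c"
      using noclash[OF u(2) bc u(1) b] .
    ultimately show ?thesis
      using LU b by (auto simp: clash_def split: if_splits)
  qed
  have "holds b (of_rat ((L + U) / 2) :: real) (of_rat c)" if "(b, c) \<in> B" for b c
    using sat[OF that] by (cases b) (auto simp: of_rat_less of_rat_less_eq)
  then show ?thesis by blast
qed

text \<open>The default 0 matters: it lies in the unit interval, and as a role weight it violates no
  upper bound on an existential concept in a Hintikka set.\<close>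

definition solve_bounds :: "(cmp \<times> rat) set \<Rightarrow> real" where
  "solve_bounds B =
     (if consistent_bounds B then SOME v. \<forall>(b, c) \<in> B. holds b v (of_rat c) else 0)"

lemma solve_bounds:
  assumes "finite B" "consistent_bounds B" "unit_bounds \<subseteq> B" "(b, c) \<in> B"
  shows "holds b (solve_bounds B) (of_rat c)"
proof -
  have "\<forall>(b, c) \<in> B. holds b (solve_bounds B) (of_rat c)"
    using someI_ex[OF consistent_bounds_solvable[OF assms(1-3)]] assms(2)
    by (simp add: solve_bounds_def)
  then show ?thesis using assms(4) by blast
qed

lemma solve_bounds_unit:
  assumes "finite B" "unit_bounds \<subseteq> B"
  shows "solve_bounds B \<in> {0..1}"
proof (cases "consistent_bounds B")
  case True
  have "(Ge, 0) \<in> B" "(Le, 1) \<in> B" using assms(2) by (auto simp: unit_bounds_def)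
  from this[THEN solve_bounds[OF assms(1) True assms(2)]] show ?thesis by simp
qed (simp add: solve_bounds_def)


section \<open>Hintikka sets\<close>

text \<open>With the unit bounds included, consistency of this set excludes all axioms on atoms at
  once: \<open>Ax_p\<close> is a clash between two assertions, \<open>Ax_0\<close> a clash with the
  lower bound 0 and \<open>Ax_1\<close> a clash with the upper bound 1.\<close>

definition atom_bounds :: "('p, 'r) assertion set \<Rightarrow> 'p \<Rightarrow> (cmp \<times> rat) set" where
  "atom_bounds H p = unit_bounds \<union> {(b, c). (Atom p, b, c) \<in> H}"

text \<open>For existential concepts only the absence of \<open>Ax_0_ex\<close> is recorded; their
  witnesses live in other Hintikka sets. Lower bounds on \<open>Ominus\<close> that fail
  \<open>nontrivial_lower\<close> demand nothing, since every nonnegative value meets them.\<close>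

fun decomposed :: "('p, 'r) assertion set \<Rightarrow> ('p, 'r) assertion \<Rightarrow> bool" where
  "decomposed H (Atom p, b, c) \<longleftrightarrow> consistent_bounds (atom_bounds H p)"
| "decomposed H (Const d, b, c) \<longleftrightarrow> holds b d c"
| "decomposed H (Neg C, b, c) \<longleftrightarrow> (C, rev_cmp b, 1 - c) \<in> H"
| "decomposed H (Ominus C d, b, c) \<longleftrightarrow>
     (b \<in> uppers \<longrightarrow> (C, b, c + d) \<in> H \<and> (Const c, rev_cmp b, 0) \<in> H) \<and>
     (nontrivial_lower b c \<longrightarrow> (C, b, c + d) \<in> H)"
| "decomposed H (Conj C D, b, c) \<longleftrightarrow>
     (b \<in> uppers \<longrightarrow> (C, b, c) \<in> H \<or> (D, b, c) \<in> H) \<and>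
     (b \<in> lowers \<longrightarrow> (C, b, c) \<in> H \<and> (D, b, c) \<in> H)"
| "decomposed H (ExR R C, b, c) \<longleftrightarrow> (b \<in> uppers \<longrightarrow> \<not> clash b Ge c 0)"

definition hintikka :: "('p, 'r) assertion set \<Rightarrow> bool" where
  "hintikka H \<longleftrightarrow> (\<forall>A \<in> H. decomposed H A)"

text \<open>Every clause asks for members of the set or does not mention the set, except that for
  atoms: further bounds can destroy consistency, so they must stay fixed.\<close>

lemma decomposed_mono:
  assumes "decomposed H A" "H \<subseteq> H'" "\<And>p. atom_bounds H' p = atom_bounds H p"
  shows "decomposed H' A"
  using assms by (cases "(H, A)" rule: decomposed.cases) auto

lemma hintikka_insert:
  assumes "hintikka H" "decomposed H A" "\<And>p. fst A \<noteq> Atom p"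
  shows "hintikka (insert A H)"
proof -
  have "atom_bounds (insert A H) p = atom_bounds H p" for p
    using assms(3)[of p] by (auto simp: atom_bounds_def)
  then have "decomposed (insert A H) B" if "decomposed H B" for B
    using that by (rule decomposed_mono[rotated 2]) auto
  then show ?thesis
    using assms(1,2) by (auto simp: hintikka_def)
qed

text \<open>Atoms, constants and existential concepts get their clauses because no axiom applies. A
  negation or conjunction cannot occur at all, nor can an \<open>Ominus\<close> on which its clause
  would make a demand, because a rule would decompose it.\<close>

lemma saturated_hintikka:
  assumes sat: "saturated (Seq P)"
  shows "hintikka P"
  unfolding hintikka_def
proof
  fix A assume A: "A \<in> P"
  have no: "\<not> prop_rule P Q" for Q
    using sat by (auto simp: saturated_def)
  \<comment> \<open>Removing \<open>A\<close> from the context meets the side condition of the rules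
    that the principal assertion is not in \<open>S\<close>.\<close>
  have P: "P = insert A (P - {A})" using A by blast
  have no': "\<not> prop_rule (insert A (P - {A})) Q" for Q
    using no P by simp
  obtain C b c where Aeq: "A = (C, b, c)" by (cases A)
  show "decomposed P A"
  proof (cases C)
    case (Atom p)
    have cross: "\<not> clash u l d e"
      if "(Atom p, u, d) \<in> P" "(Atom p, l, e) \<in> P" "u \<in> uppers" "l \<in> lowers" for u l d e
      using Ax_p[of u l d e p P] that no by (auto simp: insert_absorb)
    have up: "\<not> clash u Ge d 0" if "(Atom p, u, d) \<in> P" "u \<in> uppers" for u d
      using Ax_0[of u d p P] that no by (auto simp: insert_absorb clash_def split: if_splits)
    have lo: "\<not> clash Le l 1 d" if "(Atom p, l, d) \<in> P" "l \<in> lowers" for l d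
      using Ax_1[of l d p P] that no by (auto simp: insert_absorb clash_def split: if_splits)
    have "\<not> clash Le Ge 1 0" by (simp add: clash_def)
    then have "consistent_bounds (atom_bounds P p)"
      unfolding consistent_bounds_def atom_bounds_def unit_bounds_def
      using cross up lo by blast
    then show ?thesis using Aeq Atom by simp
  next
    case (Const d)
    then show ?thesis using no' Ax_c[of b d c "P - {A}"] Aeq by auto
  next
    case (Neg D)
    then show ?thesis using no' Neg_cmp[of D b c "P - {A}"] Aeq by auto
  next
    case (Ominus D d)
    then show ?thesis
      using no' Ominus_upper[of b D d c "P - {A}"] Ominus_lower[of b c D d "P - {A}"] Aeq
      by (auto simp: nontrivial_lower_def)
  next
    case (Conj D E)
    then show ?thesis
      using no' Conj_upper[of b D E c "P - {A}"] Conj_lower[of b D E c "P - {A}"] Aeq by auto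
  next
    case (ExR R D)
    then show ?thesis
      using no' Ax_0_ex[of b c R D "P - {A}"] Aeq by (auto simp: clash_def split: if_splits)
  qed
qed

text \<open>\<open>A\<close> is the principal assertion. The context survives in \<open>P'\<close>,
  hence in \<open>H\<close>, and what the rule adds to \<open>P'\<close> is just what the clause for
  \<open>A\<close> asks for. Axioms drop out because their only conclusion is
  \<open>Bot\<close>.\<close>

lemma prop_rule_hintikka_step:
  assumes "prop_rule P Q" "Seq P' \<in> Q" "P' \<subseteq> H"
  obtains A where "P \<subseteq> insert A H" "decomposed H A"
    "\<And>p. fst A \<noteq> Atom p" "\<And>R C. fst A \<noteq> ExR R C"
  using assms
proof (cases rule: prop_rule.cases)
  case (Conj_lower l C D c S)
  then show ?thesis using assms that[of "(Conj C D, l, c)"] by auto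
next
  case (Conj_upper u C D c S)
  then show ?thesis using assms that[of "(Conj C D, u, c)"] by auto
next
  case (Neg_cmp C b c S)
  then show ?thesis using assms that[of "(Neg C, b, c)"] by auto
next
  case (Ominus_upper u C c d S)
  then show ?thesis
    using assms that[of "(Ominus C c, u, d)"] by (auto simp: nontrivial_lower_def)
next
  case (Ominus_lower l d C c S)
  then show ?thesis
    using assms that[of "(Ominus C c, l, d)"] by (auto simp: nontrivial_lower_def)
qed auto

(* The rule for C \<ominus> c \<triangleleft> d introduces constants d that may lie outside the unit interval. *)
definition wf_assertions :: "('p, 'r) assertion set \<Rightarrow> bool" where
  "wf_assertions P \<longleftrightarrow> (\<forall>(C, b, c) \<in> P. wf_concept C \<or> (\<exists>d. C = Const d))"

lemma wf_concept_simps [simp]: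
  "wf_concept (Neg C) \<longleftrightarrow> wf_concept C"
  "wf_concept (Ominus C c) \<longleftrightarrow> c \<in> {0..1} \<and> wf_concept C"
  "wf_concept (Conj C D) \<longleftrightarrow> wf_concept C \<and> wf_concept D"
  "wf_concept (ExR R C) \<longleftrightarrow> wf_concept C"
  "wf_concept (Const c) \<longleftrightarrow> c \<in> {0..1}"
  by (auto simp: wf_concept_def)

lemma prop_rule_preserves:
  assumes "prop_rule P Q" "Seq P' \<in> Q" "finite P" "wf_assertions P"
  shows "finite P' \<and> wf_assertions P'"
  using assms by (cases rule: prop_rule.cases) (auto simp: wf_assertions_def)

section \<open>Conclusions of the existential rule\<close>

definition ex_conclusion ::
    "('p, 'r) concept \<Rightarrow> ('p, 'r) assertion set \<Rightarrow> 'r \<Rightarrow> ('p, 'r) concept \<Rightarrow> cmp \<Rightarrow> rat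
      \<Rightarrow> ('p, 'r) assertion set" where
  "ex_conclusion T P R C l c =
     {(D, u, d) | D u d. (ExR R D, u, d) \<in> P \<and> u \<in> uppers \<and> clash u l d c}
       \<union> {(C, l, c), (T, Ge, 1)}"

lemma nontrivial_lowerD: "nontrivial_lower l c \<Longrightarrow> l \<in> lowers"
  by (auto simp: nontrivial_lower_def)

lemma ex_rule_iff:
  "ex_rule T P Q \<longleftrightarrow>
     (\<exists>R C l c. (ExR R C, l, c) \<in> P \<and> nontrivial_lower l c \<and> Q = ex_conclusion T P R C l c)"
proof
  assume "ex_rule T P Q"
  then show "\<exists>R C l c. (ExR R C, l, c) \<in> P \<and> nontrivial_lower l c \<and> Q = ex_conclusion T P R C l c"
  proof cases
    case (1 R C l c)
    then have "Q = ex_conclusion T P R C l c" by (simp only: ex_conclusion_def)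
    with 1(2,4) show ?thesis by (intro exI conjI)
  qed
next
  assume "\<exists>R C l c. (ExR R C, l, c) \<in> P \<and> nontrivial_lower l c \<and> Q = ex_conclusion T P R C l c"
  then obtain R C l c where *: "(ExR R C, l, c) \<in> P" "nontrivial_lower l c"
      "Q = ex_conclusion T P R C l c" by auto
  show "ex_rule T P Q"
    unfolding *(3) ex_conclusion_def using *(1) nontrivial_lowerD[OF *(2)] *(2)
    by (rule ex_rule.intros)
qed

lemma finite_ex_conclusion:
  assumes "finite P"
  shows "finite (ex_conclusion T P R C l c)"
proof -
  have "{(D, u, d) | D u d. (ExR R D, u, d) \<in> P \<and> u \<in> uppers \<and> clash u l d c}
      \<subseteq> (\<lambda>(C, u, d). (case C of ExR R D \<Rightarrow> D | _ \<Rightarrow> C, u, d)) ` P"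
    by force
  then show ?thesis using assms by (simp add: ex_conclusion_def finite_subset)
qed

lemma ex_rule_preserves:
  assumes "ex_rule T P Q" "finite P" "wf_assertions P" "wf_concept T"
  shows "finite Q" "wf_assertions Q"
proof -
  from assms(1) obtain R C l c where
    Q: "Q = ex_conclusion T P R C l c" and P: "(ExR R C, l, c) \<in> P"
    unfolding ex_rule_iff by auto
  show "finite Q" unfolding Q using assms(2) by (rule finite_ex_conclusion)
  have "wf_concept D" if "(ExR R D, u, d) \<in> P" for D u d
    using bspec[OF assms(3)[unfolded wf_assertions_def] that] by simp
  then show "wf_assertions Q"
    using P assms(4) unfolding Q by (auto simp: wf_assertions_def ex_conclusion_def)
qed

text \<open>A conclusion is determined by its principal assertion, a member of \<open>P\<close>.
  This finite branching later keeps the set of individuals countable.\<close>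

lemma finite_ex_rule:
  assumes "finite P"
  shows "finite {Q. ex_rule T P Q}"
proof -
  define f where "f = (\<lambda>(E, l, c). case E of ExR R C \<Rightarrow> ex_conclusion T P R C l c | _ \<Rightarrow> {})"
  have "Q \<in> f ` P" if "ex_rule T P Q" for Q
  proof -
    from that obtain R C l c where "(ExR R C, l, c) \<in> P" "Q = ex_conclusion T P R C l c"
      unfolding ex_rule_iff by blast
    then have "Q = f (ExR R C, l, c)" "(ExR R C, l, c) \<in> P" by (simp_all add: f_def)
    then show ?thesis by blast
  qed
  then have "{Q. ex_rule T P Q} \<subseteq> f ` P" by blast
  then show ?thesis using assms finite_subset by blast
qed

section \<open>Termination of propositional decomposition and Hintikka extensions\<close>

primrec concept_weight :: "('p, 'r) concept \<Rightarrow> nat" where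
  "concept_weight (Atom p) = 0"
| "concept_weight (Const c) = 0"
| "concept_weight (Neg C) = Suc (concept_weight C)"
| "concept_weight (Ominus C c) = Suc (concept_weight C)"
| "concept_weight (Conj C D) = Suc (concept_weight C + concept_weight D)"
| "concept_weight (ExR R C) = 0"

definition sequent_weight :: "('p, 'r) assertion set \<Rightarrow> nat" where
  "sequent_weight P = (\<Sum>A \<in> P. concept_weight (fst A))"

lemma sequent_weight_insert_le:
  "finite S \<Longrightarrow> sequent_weight (insert A S) \<le> concept_weight (fst A) + sequent_weight S"
  by (cases "A \<in> S") (auto simp: sequent_weight_def insert_absorb)

lemma sequent_weight_insert:
  "finite S \<Longrightarrow> A \<notin> S \<Longrightarrow> sequent_weight (insert A S) = concept_weight (fst A) + sequent_weight S"
  by (auto simp: sequent_weight_def)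

text \<open>The principal assertion really leaves the sequent, and its parts weigh less than it does
  in total, even when both conjuncts are added; the constant assertion added by
  \<open>Ominus_upper\<close> weighs 0. Parts already present in the context only make the sum
  smaller.\<close>

lemma prop_rule_decreases:
  assumes "prop_rule P Q" "Seq P' \<in> Q" "finite P"
  shows "sequent_weight P' < sequent_weight P"
proof -
  have two: "sequent_weight (insert A (insert B S)) \<le> concept_weight (fst A) + concept_weight (fst B) + sequent_weight S"
    if "finite S" for A B :: "('a, 'b) assertion" and S
    using sequent_weight_insert_le[of "insert B S" A] sequent_weight_insert_le[of S B] that
    by simp
  show ?thesis using assms
  proof (cases rule: prop_rule.cases)
    case (Conj_lower l C D c S)
    then show ?thesis
      using assms two[of S "(C, l, c)" "(D, l, c)"] by (auto simp: sequent_weight_insert insert_commute)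
  next
    case (Conj_upper u C D c S)
    then show ?thesis
      using assms sequent_weight_insert_le[of S "(C, u, c)"] sequent_weight_insert_le[of S "(D, u, c)"]
      by (auto simp: sequent_weight_insert)
  next
    case (Neg_cmp C b c S)
    then show ?thesis
      using assms sequent_weight_insert_le[of S "(C, rev_cmp b, 1 - c)"]
      by (auto simp: sequent_weight_insert)
  next
    case (Ominus_upper u C c d S)
    then show ?thesis
      using assms two[of S "(C, u, d + c)" "(Const d, rev_cmp u, 0)"]
      by (auto simp: sequent_weight_insert insert_commute)
  next
    case (Ominus_lower l d C c S)
    then show ?thesis
      using assms sequent_weight_insert_le[of S "(C, l, d + c)"]
      by (auto simp: sequent_weight_insert)
  qed auto
qed

text \<open>Besides \<open>T\<close>, only the existential assertions of the premise enter a
  conclusion, so adding any other assertion yields no new ones.\<close>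

lemma ex_rule_insert:
  assumes "ex_rule T (insert A H) Q" "\<And>R C. fst A \<noteq> ExR R C"
  shows "ex_rule T H Q"
proof -
  have iff: "(ExR R D, u, d) \<in> insert A H \<longleftrightarrow> (ExR R D, u, d) \<in> H" for R D u d
    using assms(2)[of R D] by auto
  show ?thesis
    using assms(1) unfolding ex_rule_iff ex_conclusion_def iff .
qed

(* The sequents labelling a consistent marking, abstracted from the graph. *)
locale open_sequents =
  fixes T :: "('p, 'r) concept" and \<L> :: "('p, 'r) assertion set set"
  assumes finite_sequent: "P \<in> \<L> \<Longrightarrow> finite P"
    and wf_sequent: "P \<in> \<L> \<Longrightarrow> wf_assertions P"
    and or_step: "P \<in> \<L> \<Longrightarrow> \<not> saturated (Seq P) \<Longrightarrow> \<exists>Q P'. prop_rule P Q \<and> Seq P' \<in> Q \<and> P' \<in> \<L>"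
    and and_step: "P \<in> \<L> \<Longrightarrow> saturated (Seq P) \<Longrightarrow> ex_rule T P Q \<Longrightarrow> Q \<in> \<L>"
begin

text \<open>The last conjunct lets the construction continue: each conclusion is a sequent of the
  marking again and has an extension of its own.\<close>

definition hintikka_extension :: "('p, 'r) assertion set \<Rightarrow> ('p, 'r) assertion set \<Rightarrow> bool" where
  "hintikka_extension P H \<longleftrightarrow>
     P \<subseteq> H \<and> finite H \<and> wf_assertions H \<and> hintikka H \<and> (\<forall>Q. ex_rule T H Q \<longrightarrow> Q \<in> \<L>)"

text \<open>A saturated sequent is its own extension. Otherwise an extension of the chosen
  conclusion, which has smaller weight, is enlarged by the principal assertion of the rule.\<close>

lemma hintikka_extension_exists:
  assumes "P \<in> \<L>"
  shows "\<exists>H. hintikka_extension P H"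
  using assms
proof (induction "sequent_weight P" arbitrary: P rule: less_induct)
  case less
  show ?case
  proof (cases "saturated (Seq P)")
    case True
    then have "hintikka_extension P P"
      using less.prems finite_sequent wf_sequent and_step saturated_hintikka
      by (auto simp: hintikka_extension_def)
    then show ?thesis ..
  next
    case False
    then obtain Q P' where step: "prop_rule P Q" "Seq P' \<in> Q" "P' \<in> \<L>"
      using or_step less.prems by blast
    then obtain H where H: "hintikka_extension P' H"
      using less prop_rule_decreases finite_sequent by blast
    then have "P' \<subseteq> H" by (simp add: hintikka_extension_def)
    from step(1,2) this obtain A where A: "P \<subseteq> insert A H" "decomposed H A"
      "\<And>p. fst A \<noteq> Atom p" "\<And>R C. fst A \<noteq> ExR R C"
      by (rule prop_rule_hintikka_step) blast
    show ?thesis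
    \<comment> \<open>If \<open>A\<close> lies in \<open>P\<close>, it inherits well-formedness from
      there; if not, \<open>H\<close> already covers \<open>P\<close>.\<close>
    proof (cases "A \<in> P")
      case True
      have "wf_assertions (insert A H)"
        using True less.prems wf_sequent[of P] H
        by (auto simp: wf_assertions_def hintikka_extension_def)
      then have "hintikka_extension P (insert A H)"
        using A H hintikka_insert[of H A] ex_rule_insert[of T A H]
        by (auto simp: hintikka_extension_def)
      then show ?thesis ..
    next
      case False
      then have "P \<subseteq> H" using A by blast
      then have "hintikka_extension P H" using H by (simp add: hintikka_extension_def)
      then show ?thesis ..
    qed
  qed
qed

end

section \<open>Truth values in the unit interval and monotonicity of bounds\<close>

lemma ceval_unit:
  assumes "interpretation_ok I" "wf_concept C" "x \<in> indivs I"
  shows "ceval I C x \<in> {0..1}"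
  using assms(2,3)
proof (induction C arbitrary: x)
  case (Atom p)
  then show ?case using assms(1) by (auto simp: interpretation_ok_def)
next
  case (Const c)
  then show ?case by simp
next
  case (Neg C)
  then show ?case by fastforce
next
  case (Ominus C c)
  then have "ceval I C x \<in> {0..1}" by simp
  moreover have "(0 :: real) \<le> of_rat c" using Ominus by simp
  ultimately show ?case by (simp del: zero_le_of_rat_iff)
next
  case (Conj C D)
  then have "ceval I C x \<in> {0..1}" "ceval I D x \<in> {0..1}" by simp_all
  then show ?case by (simp add: min_def)
next
  case (ExR R C)
  have ne: "indivs I \<noteq> {}" using assms(1) by (simp add: interpretation_ok_def)
  have r: "min (role_val I R x y) (ceval I C y) \<in> {0..1}" if "y \<in> indivs I" for y
  proof -
    have "ceval I C y \<in> {0..1}" using ExR that by simp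
    moreover have "role_val I R x y \<in> {0..1}"
      using assms(1) ExR.prems(2) that by (auto simp: interpretation_ok_def)
    ultimately show ?thesis by (simp add: min_def)
  qed
  have bdd: "bdd_above ((\<lambda>y. min (role_val I R x y) (ceval I C y)) ` indivs I)"
    using r by (intro bdd_aboveI2[of _ _ 1]) fastforce
  \<comment> \<open>The individual \<open>x\<close> itself supplies a nonnegative term of the
    supremum.\<close>
  have "0 \<le> (SUP y \<in> indivs I. min (role_val I R x y) (ceval I C y))"
    using r[OF ExR.prems(2)] by (intro cSUP_upper2[OF bdd ExR.prems(2)]) simp
  moreover have "(SUP y \<in> indivs I. min (role_val I R x y) (ceval I C y)) \<le> 1"
    using r by (intro cSUP_least[OF ne]) fastforce
  ultimately show ?case by simp
qed


lemma holds_upper_mono: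
  fixes v w :: "'a :: order"
  assumes "u \<in> uppers" "holds u w d" "v \<le> w"
  shows "holds u v d"
  using assms by auto

lemma holds_lower_mono:
  fixes v w :: "'a :: order"
  assumes "l \<in> lowers" "holds l v d" "v \<le> w"
  shows "holds l w d"
  using assms by auto


section \<open>The model of a family of Hintikka sets\<close>

locale hintikka_family =
  fixes T :: "('p, 'r) concept" and I :: "'i set" and H :: "'i \<Rightarrow> ('p, 'r) assertion set"
  assumes nonempty: "I \<noteq> {}"
    and finite_H: "x \<in> I \<Longrightarrow> finite (H x)"
    and wf_H: "x \<in> I \<Longrightarrow> wf_assertions (H x)"
    and hintikka_H: "x \<in> I \<Longrightarrow> hintikka (H x)"
    and successor: "x \<in> I \<Longrightarrow> ex_rule T (H x) Q \<Longrightarrow> \<exists>y \<in> I. Q \<subseteq> H y"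
begin

definition succ :: "'i \<Rightarrow> 'r \<Rightarrow> ('p, 'r) concept \<Rightarrow> cmp \<Rightarrow> rat \<Rightarrow> 'i" where
  "succ x R C l c = (SOME y. y \<in> I \<and> ex_conclusion T (H x) R C l c \<subseteq> H y)"

text \<open>A minimum is small as soon as one argument is. Upper bounds that clash with the lower
  bound \<open>c\<close> must be met by the filler at the successor; all others are left to the role
  and collected here.\<close>

definition role_bounds :: "'i \<Rightarrow> 'r \<Rightarrow> cmp \<Rightarrow> rat \<Rightarrow> (cmp \<times> rat) set" where
  "role_bounds x R l c = unit_bounds \<union> {(l, c)} \<union>
     {(u, d). \<exists>D. (ExR R D, u, d) \<in> H x \<and> u \<in> uppers \<and> \<not> clash u l d c}"

definition role_weights :: "'i \<Rightarrow> 'r \<Rightarrow> 'i \<Rightarrow> real set" where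
  "role_weights x R y = {solve_bounds (role_bounds x R l c) | C l c.
     (ExR R C, l, c) \<in> H x \<and> nontrivial_lower l c \<and> succ x R C l c = y}"

(* Several existential assertions may share a successor; each of them alone already respects
   all upper bounds on the role, so the maximum of their weights does too. *)
definition model :: "('i, 'p, 'r) interp" where
  "model = \<lparr>indivs = I,
     atom_val = (\<lambda>p x. solve_bounds (atom_bounds (H x) p)),
     role_val = (\<lambda>R x y. Max (insert 0 (role_weights x R y)))\<rparr>"

lemma finite_image_snd_H: "x \<in> I \<Longrightarrow> finite (snd ` H x)"
  using finite_H by simp

lemma finite_atom_bounds: "x \<in> I \<Longrightarrow> finite (atom_bounds (H x) p)"
proof -
  assume "x \<in> I"
  moreover have "{(b, c). (Atom p, b, c) \<in> H x} \<subseteq> snd ` H x" by force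
  ultimately show ?thesis
    using finite_image_snd_H finite_subset by (auto simp: atom_bounds_def unit_bounds_def)
qed

lemma finite_role_bounds: "x \<in> I \<Longrightarrow> finite (role_bounds x R l c)"
proof -
  assume "x \<in> I"
  moreover have "{(u, d). \<exists>D. (ExR R D, u, d) \<in> H x \<and> u \<in> uppers \<and> \<not> clash u l d c}
      \<subseteq> snd ` H x" by force
  ultimately show ?thesis
    using finite_image_snd_H finite_subset by (fastforce simp: role_bounds_def unit_bounds_def)
qed

lemma finite_role_weights:
  assumes "x \<in> I"
  shows "finite (role_weights x R y)"
proof -
  have "role_weights x R y \<subseteq> (\<lambda>(C, l, c). solve_bounds (role_bounds x R l c)) ` H x"
    by (force simp: role_weights_def)
  then show ?thesis using finite_H[OF assms] finite_subset by blast
qed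

lemma succ:
  assumes "x \<in> I" "(ExR R C, l, c) \<in> H x" "nontrivial_lower l c"
  shows "succ x R C l c \<in> I" "ex_conclusion T (H x) R C l c \<subseteq> H (succ x R C l c)"
proof -
  have "ex_rule T (H x) (ex_conclusion T (H x) R C l c)"
    unfolding ex_rule_iff using assms(2,3) by auto
  then have "\<exists>y. y \<in> I \<and> ex_conclusion T (H x) R C l c \<subseteq> H y"
    using successor[OF assms(1)] by auto
  from someI_ex[OF this] show "succ x R C l c \<in> I"
    "ex_conclusion T (H x) R C l c \<subseteq> H (succ x R C l c)"
    unfolding succ_def by auto
qed

lemma ExR_upper_nonneg:
  assumes "x \<in> I" "(ExR R C, u, d) \<in> H x" "u \<in> uppers"
  shows "\<not> clash u Ge d 0"
  using hintikka_H[OF assms(1)] assms(2,3) by (force simp: hintikka_def)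

lemma holds_upper_zero:
  "u \<in> uppers \<Longrightarrow> \<not> clash u Ge d 0 \<Longrightarrow> holds u (0 :: real) (of_rat d)"
  by (auto simp: clash_def split: if_splits)

lemma unit_subset_role_bounds: "unit_bounds \<subseteq> role_bounds x R l c"
  by (auto simp: role_bounds_def)

lemma role_weight_upper:
  assumes "x \<in> I" "(ExR R D, u, d) \<in> H x" "u \<in> uppers" "\<not> clash u l d c"
  shows "holds u (solve_bounds (role_bounds x R l c)) (of_rat d)"
proof (cases "consistent_bounds (role_bounds x R l c)")
  case True
  have "(u, d) \<in> role_bounds x R l c"
    using assms(2-4) unfolding role_bounds_def by blast
  then show ?thesis
    by (rule solve_bounds[OF finite_role_bounds[OF assms(1)] True unit_subset_role_bounds])
next
  case False
  then show ?thesis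
    using holds_upper_zero[OF assms(3) ExR_upper_nonneg[OF assms(1-3)]]
    by (simp add: solve_bounds_def)
qed

text \<open>No two bounds clash: \<open>c\<close> agrees with the collected upper bounds by their
  selection and with 1 by hypothesis, and 0 agrees with all of them by
  \<open>ExR_upper_nonneg\<close>.\<close>

lemma role_weight_lower:
  assumes "x \<in> I" "nontrivial_lower l c" "\<not> clash Le l 1 c"
  shows "holds l (solve_bounds (role_bounds x R l c)) (of_rat c)"
proof -
  have l: "l \<in> lowers" by (rule nontrivial_lowerD[OF assms(2)])
  have "consistent_bounds (role_bounds x R l c)"
    unfolding consistent_bounds_def
  proof (intro allI impI)
    fix u d l' d'
    assume ud: "(u, d) \<in> role_bounds x R l c" "u \<in> uppers"
      and ld: "(l', d') \<in> role_bounds x R l c" "l' \<in> lowers"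
    from ud l have u: "(u, d) = (Le, 1) \<or> (\<exists>D. (ExR R D, u, d) \<in> H x \<and> \<not> clash u l d c)"
      by (auto simp: role_bounds_def unit_bounds_def)
    have "\<not> clash u l d c" using u assms(3) by blast
    moreover have "\<not> clash u Ge d 0"
      using u ExR_upper_nonneg[OF assms(1) _ ud(2)] by (auto simp: clash_def)
    moreover have "(l', d') = (l, c) \<or> (l', d') = (Ge, 0)"
      using ld by (auto simp: role_bounds_def unit_bounds_def)
    ultimately show "\<not> clash u l' d d'" by auto
  qed
  moreover have "(l, c) \<in> role_bounds x R l c" by (simp add: role_bounds_def)
  ultimately show ?thesis
    by (rule solve_bounds[OF finite_role_bounds[OF assms(1)] _ unit_subset_role_bounds])
qed

lemma role_weights_unit: "x \<in> I \<Longrightarrow> r \<in> role_weights x R y \<Longrightarrow> r \<in> {0..1}"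
  using solve_bounds_unit[OF finite_role_bounds unit_subset_role_bounds]
  by (auto simp: role_weights_def)

lemma role_val_cases:
  assumes "x \<in> I"
  obtains "role_val model R x y = 0" | "role_val model R x y \<in> role_weights x R y"
  using Max_in[of "insert 0 (role_weights x R y)"] finite_role_weights[OF assms]
  by (auto simp: model_def)

lemma interpretation_ok_model: "interpretation_ok model"
proof -
  have "role_val model R x y \<in> {0..1}" if "x \<in> I" for R x y
    using that role_weights_unit[OF that] by (cases rule: role_val_cases[of x R y]) auto
  moreover have "atom_val model p x \<in> {0..1}" if "x \<in> I" for p x
    using solve_bounds_unit[OF finite_atom_bounds[OF that, of p]]
    by (simp add: model_def atom_bounds_def)
  moreover have "indivs model = I" by (simp add: model_def)
  ultimately show ?thesis
    using nonempty unfolding interpretation_ok_def by simp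
qed

lemma indivs_model [simp]: "indivs model = I"
  by (simp add: model_def)

lemma role_val_unit: "x \<in> I \<Longrightarrow> y \<in> I \<Longrightarrow> role_val model R x y \<in> {0..1}"
  using interpretation_ok_model by (simp add: interpretation_ok_def)

lemma bdd_above_ExR:
  "x \<in> I \<Longrightarrow> bdd_above ((\<lambda>y. min (role_val model R x y) (f y)) ` I)"
  using role_val_unit by (intro bdd_aboveI2[of _ _ 1]) (fastforce simp: min_le_iff_disj)

text \<open>A nonzero role value is the weight of some assertion in \<open>H x\<close>, and each
  assertion contributes only to its one chosen successor.\<close>

lemma finite_role_successors:
  assumes "x \<in> I"
  shows "finite {y \<in> I. role_val model R x y \<noteq> 0}"
proof -
  have "{y \<in> I. role_val model R x y \<noteq> 0}
      \<subseteq> (\<lambda>(E, l, c). succ x R (case E of ExR R C \<Rightarrow> C | _ \<Rightarrow> E) l c) ` H x"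
  proof
    fix y assume "y \<in> {y \<in> I. role_val model R x y \<noteq> 0}"
    then have "role_val model R x y \<in> role_weights x R y"
      using role_val_cases[OF assms] by blast
    then obtain C l c where "(ExR R C, l, c) \<in> H x" "y = succ x R C l c"
      by (auto simp: role_weights_def)
    then show "y \<in> (\<lambda>(E, l, c). succ x R (case E of ExR R C \<Rightarrow> C | _ \<Rightarrow> E) l c) ` H x"
      by force
  qed
  then show ?thesis using finite_H[OF assms] finite_subset by blast
qed

(* Finitely many successors make the supremum a maximum, which preserves strict bounds. *)
lemma ExR_upper:
  assumes x: "x \<in> I" and A: "(ExR R C, u, d) \<in> H x" "u \<in> uppers"
    and IH: "\<And>y. y \<in> I \<Longrightarrow> (C, u, d) \<in> H y \<Longrightarrow> holds u (ceval model C y) (of_rat d)"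
  shows "holds u (ceval model (ExR R C) x) (of_rat d)"
proof -
  let ?f = "\<lambda>y. min (role_val model R x y) (ceval model C y)"
  let ?Y = "{y \<in> I. role_val model R x y \<noteq> 0}"
  have zero: "holds u (0 :: real) (of_rat d)"
    by (rule holds_upper_zero[OF A(2) ExR_upper_nonneg[OF x A]])
  have f: "holds u (?f y) (of_rat d)" if y: "y \<in> I" for y
  proof (cases rule: role_val_cases[OF x, of R y])
    case 1
    then show ?thesis using holds_upper_mono[OF A(2) zero] by simp
  next
    case 2
    then obtain E l c where E: "(ExR R E, l, c) \<in> H x" "nontrivial_lower l c" "succ x R E l c = y"
      "role_val model R x y = solve_bounds (role_bounds x R l c)"
      by (auto simp: role_weights_def)
    \<comment> \<open>The edge carries the weight of the single assertion on \<open>E\<close>. If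
      \<open>(u, d)\<close> clashes with its bound, \<open>(C, u, d)\<close> was handed on and the
      filler is small; otherwise the role weight is.\<close>
    show ?thesis
    proof (cases "clash u l d c")
      case True
      then have "(C, u, d) \<in> ex_conclusion T (H x) R E l c"
        using A by (auto simp: ex_conclusion_def)
      then have "(C, u, d) \<in> H y" using succ(2)[OF x E(1,2)] E(3) by blast
      then show ?thesis using holds_upper_mono[OF A(2) IH[OF y]] by simp
    next
      case False
      then show ?thesis
        using holds_upper_mono[OF A(2) role_weight_upper[OF x A False]] E(4) by simp
    qed
  qed
  \<comment> \<open>The 0 dominates the terms of all individuals outside \<open>?Y\<close> and
    covers the case that \<open>?Y\<close> is empty.\<close>
  let ?m = "Max (insert 0 (?f ` ?Y))"
  have fin: "finite (insert 0 (?f ` ?Y))" using finite_role_successors[OF x] by simp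
  have "?f y \<le> ?m" if "y \<in> I" for y
  proof (cases "role_val model R x y = 0")
    case True
    have "0 \<le> ?m" using fin by (intro Max_ge) auto
    with True show ?thesis by simp
  next
    case False
    with that fin show ?thesis by (intro Max_ge) auto
  qed
  then have "ceval model (ExR R C) x \<le> ?m"
    using nonempty by (auto intro: cSUP_least)
  moreover have "?m \<in> insert 0 (?f ` ?Y)" using fin by (rule Max_in) simp
  then have "holds u ?m (of_rat d)"
  proof
    assume "?m = 0"
    then show ?thesis using zero by (simp only:)
  next
    assume "?m \<in> ?f ` ?Y"
    then obtain y where y: "y \<in> I" "?m = ?f y" by auto
    show ?thesis unfolding y(2) by (rule f[OF y(1)])
  qed
  ultimately show ?thesis using holds_upper_mono[OF A(2)] by blast
qed

text \<open>A trivial bound holds because values are nonnegative. For a nontrivial one the chosen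
  successor is the witness: it satisfies the filler assertion, and the role value there is at least
  the weight chosen for this assertion.\<close>

lemma ExR_lower:
  assumes x: "x \<in> I" and A: "(ExR R C, l, c) \<in> H x" "l \<in> lowers"
    and IH: "\<And>y. y \<in> I \<Longrightarrow> (C, l, c) \<in> H y \<Longrightarrow> holds l (ceval model C y) (of_rat c)"
  shows "holds l (ceval model (ExR R C) x) (of_rat c)"
proof -
  have wf: "wf_concept C"
    using bspec[OF wf_H[OF x, unfolded wf_assertions_def] A(1)] by simp
  show ?thesis
  proof (cases "nontrivial_lower l c")
    case False
    have "0 \<le> ceval model (ExR R C) x"
      using ceval_unit[OF interpretation_ok_model, of "ExR R C" x] wf x by simp
    moreover have "holds l (0 :: real) (of_rat c)"
      using False A(2) by (auto simp: nontrivial_lower_def)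
    ultimately show ?thesis using holds_lower_mono[OF A(2)] by blast
  next
    case True
    define y where "y = succ x R C l c"
    have y: "y \<in> I" "ex_conclusion T (H x) R C l c \<subseteq> H y"
      unfolding y_def using succ[OF x A(1) True] by auto
    then have C: "holds l (ceval model C y) (of_rat c)"
      by (intro IH) (auto simp: ex_conclusion_def)
    \<comment> \<open>No axiom compares a lower bound on an existential concept with 1. That
      \<open>c\<close> is attainable follows instead from the filler, whose value is at most 1 and
      meets the bound.\<close>
    have "holds l (1 :: real) (of_rat c)"
      using holds_lower_mono[OF A(2) C] ceval_unit[OF interpretation_ok_model wf, of y] y(1) by simp
    then have "\<not> clash Le l 1 c"
      using A(2) by (auto simp: clash_def)
    then have w: "holds l (solve_bounds (role_bounds x R l c)) (of_rat c)"
      by (rule role_weight_lower[OF x True])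
    have "solve_bounds (role_bounds x R l c) \<in> role_weights x R y"
      using A(1) True y_def unfolding role_weights_def by blast
    then have "solve_bounds (role_bounds x R l c) \<le> role_val model R x y"
      using finite_role_weights[OF x] by (auto simp: model_def intro: Max_ge)
    then have "holds l (role_val model R x y) (of_rat c)"
      by (rule holds_lower_mono[OF A(2) w])
    with C have "holds l (min (role_val model R x y) (ceval model C y)) (of_rat c)"
      by (simp add: min_def)
    moreover have "min (role_val model R x y) (ceval model C y) \<le> ceval model (ExR R C) x"
      using cSUP_upper[OF y(1) bdd_above_ExR[OF x, of R "ceval model C"]] by simp
    ultimately show ?thesis by (rule holds_lower_mono[OF A(2)])
  qed
qed

text \<open>Each connective follows its clause of \<open>decomposed\<close>. The individual and the
  bound are generalised because existential concepts lead to other individuals, and negation and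
  \<open>Ominus\<close> change the bound.\<close>

lemma truth:
  assumes "x \<in> I" "(C, b, c) \<in> H x"
  shows "holds b (ceval model C x) (of_rat c)"
  using assms
proof (induction C arbitrary: x b c)
  case (Atom p)
  then have "consistent_bounds (atom_bounds (H x) p)"
    using hintikka_H by (force simp: hintikka_def)
  moreover have "(b, c) \<in> atom_bounds (H x) p" "unit_bounds \<subseteq> atom_bounds (H x) p"
    using Atom by (auto simp: atom_bounds_def)
  ultimately have "holds b (solve_bounds (atom_bounds (H x) p)) (of_rat c)"
    using solve_bounds[OF finite_atom_bounds[OF Atom(1)]] by blast
  then show ?case by (simp add: model_def)
next
  case (Const d)
  then have "holds b d c" using hintikka_H by (force simp: hintikka_def)
  then show ?case by (cases b) (auto simp: of_rat_less of_rat_less_eq)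
next
  case (Neg C)
  then have "(C, rev_cmp b, 1 - c) \<in> H x" using hintikka_H by (force simp: hintikka_def)
  from Neg.IH[OF Neg.prems(1) this] show ?case by (cases b) (auto simp: of_rat_diff)
next
  case (Ominus C d)
  have dec: "decomposed (H x) (Ominus C d, b, c)"
    using Ominus.prems hintikka_H by (force simp: hintikka_def)
  have IH: "holds b (ceval model C x) (of_rat c + of_rat d)" if "(C, b, c + d) \<in> H x"
    using Ominus.IH[OF Ominus.prems(1) that] by (simp add: of_rat_add)
  show ?case
  proof (cases "b \<in> uppers")
    case True
    \<comment> \<open>An upper bound on a maximum with 0 must be met by 0 as well; the constant
      assertion says just that.\<close>
    then have "(Const c, rev_cmp b, 0) \<in> H x" using dec by simp
    then have "decomposed (H x) (Const c, rev_cmp b, 0)"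
      using Ominus.prems hintikka_H unfolding hintikka_def by blast
    then have "holds (rev_cmp b) c 0" by simp
    then show ?thesis using IH dec True by auto
  next
    case False
    then have b: "b \<in> lowers" by (cases b) auto
    show ?thesis
    proof (cases "nontrivial_lower b c")
      case True
      then show ?thesis using IH dec b by auto
    next
      case False
      \<comment> \<open>Such a bound is already met by 0, the least value of the maximum.\<close>
      then have "of_rat c \<le> (0 :: real) \<and> (b = Gt \<longrightarrow> of_rat c < (0 :: real))"
        using b by (auto simp: nontrivial_lower_def)
      then show ?thesis using b by (auto simp del: of_rat_le_0_iff of_rat_less_0_iff)
    qed
  qed
next
  case (Conj C D)
  have dec: "decomposed (H x) (Conj C D, b, c)"
    using Conj.prems hintikka_H by (force simp: hintikka_def)
  have IH: "(C, b, c) \<in> H x \<Longrightarrow> holds b (ceval model C x) (of_rat c)"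
    "(D, b, c) \<in> H x \<Longrightarrow> holds b (ceval model D x) (of_rat c)"
    using Conj by blast+
  show ?case using dec IH by (cases b) auto
next
  case (ExR R C)
  show ?case
  proof (cases "b \<in> uppers")
    case True
    then show ?thesis using ExR_upper[OF ExR.prems(1,2)] ExR.IH by blast
  next
    case False
    then have "b \<in> lowers" by (cases b) auto
    then show ?thesis using ExR_lower[OF ExR.prems(1,2)] ExR.IH by blast
  qed
qed

end

section \<open>Closing off from the root under the existential rule\<close>

lemma (in open_sequents) hintikka_family_exists:
  assumes "P\<^sub>0 \<in> \<L>" "(T, Ge, 1) \<in> P\<^sub>0"
  obtains I :: "nat set" and H x where "hintikka_family T I H" "x \<in> I" "P\<^sub>0 \<subseteq> H x"
    "\<And>y. y \<in> I \<Longrightarrow> (T, Ge, 1) \<in> H y"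
proof -
  define h where "h P = (SOME H. hintikka_extension P H)" for P
  have h: "hintikka_extension P (h P)" if "P \<in> \<L>" for P
    unfolding h_def using someI_ex[OF hintikka_extension_exists[OF that]] .
  \<comment> \<open>The existential rule is applied to the chosen extension of \<open>P\<close>, not
    to \<open>P\<close>. Each \<open>P\<close> has finitely many \<open>r\<close>-successors, so the
    set \<open>W\<close> reached from the root is countable.\<close>
  define r where "r = {(P, Q). P \<in> \<L> \<and> ex_rule T (h P) Q}"
  define W where "W = r\<^sup>* `` {P\<^sub>0}"
  have "countable (r `` {P})" for P
  proof (cases "P \<in> \<L>")
    case True
    then have "finite (h P)" using h by (simp add: hintikka_extension_def)
    from finite_ex_rule[OF this, of T] show ?thesis
      by (intro countable_finite) (simp add: r_def Image_def True)
  next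
    case False
    then have "r `` {P} = {}" by (auto simp: r_def)
    then show ?thesis by simp
  qed
  then have "countable (r `` Y)" if "countable Y" for Y
    using that unfolding Image_eq_UN[of r Y] by (intro countable_UN) auto
  then have cW: "countable W"
    unfolding W_def by (intro countable_rtrancl) auto
  \<comment> \<open>Every member of \<open>W\<close> is the starting sequent or a conclusion of
    \<open>ex_rule\<close>, and all conclusions contain the assertion on \<open>T\<close>.\<close>
  have W: "P \<in> \<L> \<and> (T, Ge, 1) \<in> P" if "P \<in> W" for P
  proof -
    from that have "(P\<^sub>0, P) \<in> r\<^sup>*" by (simp add: W_def)
    then show ?thesis
    proof (cases rule: rtranclE)
      case base
      then show ?thesis using assms by simp
    next
      case (step P')
      then have "P' \<in> \<L>" "ex_rule T (h P') P" by (auto simp: r_def)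
      moreover from this have "P \<in> \<L>" using h by (simp add: hintikka_extension_def)
      ultimately show ?thesis by (auto simp: ex_rule_iff ex_conclusion_def)
    qed
  qed
  have W0: "P\<^sub>0 \<in> W" by (simp add: W_def)
  have Wstep: "Q \<in> W" if "P \<in> W" "ex_rule T (h P) Q" for P Q
  proof -
    have "(P, Q) \<in> r" using W[OF that(1)] that(2) by (simp add: r_def)
    then show ?thesis using that(1) unfolding W_def by (auto intro: rtrancl_into_rtrancl)
  qed
  \<comment> \<open>Individuals are numbers coding the sequents in \<open>W\<close>; each is
    interpreted by the extension of the sequent it codes.\<close>
  define I where "I = to_nat_on W ` W"
  define H where "H x = h (from_nat_into W x)" for x
  have H: "H (to_nat_on W P) = h P" if "P \<in> W" for P
    using that cW by (simp add: H_def)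
  have ext: "hintikka_extension P (h P)" if "P \<in> W" for P
    using h W that by blast
  show thesis
  proof
    show "hintikka_family T I H"
    proof
      show "I \<noteq> {}" using W0 by (auto simp: I_def)
    next
      fix x assume "x \<in> I"
      then obtain P where P: "P \<in> W" "x = to_nat_on W P" by (auto simp: I_def)
      show "finite (H x)" "wf_assertions (H x)" "hintikka (H x)"
        using ext[OF P(1)] by (simp_all add: H P hintikka_extension_def)
      fix Q assume "ex_rule T (H x) Q"
      then have "Q \<in> W" using Wstep P H by simp
      then have "to_nat_on W Q \<in> I" "Q \<subseteq> H (to_nat_on W Q)"
        using ext[of Q] by (simp_all add: I_def H hintikka_extension_def)
      then show "\<exists>y \<in> I. Q \<subseteq> H y" by blast
    qed
    show "to_nat_on W P\<^sub>0 \<in> I" using W0 by (simp add: I_def)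
    show "P\<^sub>0 \<subseteq> H (to_nat_on W P\<^sub>0)"
      using ext[OF W0] by (simp add: H W0 hintikka_extension_def)
    show "(T, Ge, 1) \<in> H y" if "y \<in> I" for y
      using that W ext by (force simp: I_def H hintikka_extension_def)
  qed
qed


section \<open>The associated concept assertion\<close>

lemma ceval_big_conj_ge_1:
  "ceval I (big_conj Cs) x \<ge> 1 \<Longrightarrow> C \<in> set Cs \<Longrightarrow> ceval I C x \<ge> 1"
  by (induction Cs rule: big_conj.induct) auto

lemma ceval_big_disj_ge_1:
  "ceval I (big_disj Cs) x \<ge> 1 \<Longrightarrow> \<exists>C \<in> set Cs. ceval I C x \<ge> 1"
  by (induction Cs rule: big_disj.induct) (auto simp: min_def split: if_splits)

(* The disjunct for z says exactly that C \<le> z \<le> D. *)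
lemma gci_concept_ge_1:
  assumes "ceval I (gci_concept zs (C, D)) x \<ge> 1"
  shows "ceval I C x \<le> ceval I D x"
proof -
  obtain z where "ceval I (Conj (Oplus (Neg C) z) (Oplus D (1 - z))) x \<ge> 1"
    using ceval_big_disj_ge_1[OF assms[unfolded gci_concept_def]] by auto
  then show ?thesis by (simp add: of_rat_diff)
qed

lemma wf_big_conj: "(\<And>C. C \<in> set Cs \<Longrightarrow> wf_concept C) \<Longrightarrow> wf_concept (big_conj Cs)"
  by (induction Cs rule: big_conj.induct) auto

lemma wf_big_disj: "(\<And>C. C \<in> set Cs \<Longrightarrow> wf_concept C) \<Longrightarrow> wf_concept (big_disj Cs)"
  by (induction Cs rule: big_disj.induct) auto

text \<open>For \<open>z\<close> in \<open>Z\<close> other than 1, the difference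
  \<open>1 - z\<close> is a nonzero element of \<open>Z\<close> and hence at least the minimum, so
  adding half of the minimum to \<open>z\<close> stays below 1. This makes the constants in
  \<open>T\<close> admissible.\<close>

lemma Zset'_subset_unit:
  assumes "sequent \<Gamma>" "tbox TB"
  shows "Zset' TB \<Gamma> \<subseteq> {0..1}"
proof -
  let ?Z = "Zset TB \<Gamma>"
  have one: "1 \<in> group_closure (insert 1 (all_consts TB \<Gamma>))"
    by (intro group_closure.base) simp
  have fin: "finite (?Z - {0})" using finite_Zset[OF assms] by simp
  \<comment> \<open>This ensures that the minimum is taken over a nonempty set.\<close>
  have "1 \<in> ?Z - {0}" using one by (simp add: Zset_def)
  then have "Min (?Z - {0}) \<in> ?Z - {0}" using fin by (intro Min_in) auto
  then have pos: "0 \<le> Min (?Z - {0})" by (simp add: Zset_def)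
  have "z + Zeps TB \<Gamma> \<in> {0..1}" if z: "z \<in> ?Z - {1}" for z
  proof -
    have "1 - z \<in> ?Z - {0}"
      using z one by (auto simp: Zset_def intro: group_closure.diff)
    then have "Min (?Z - {0}) \<le> 1 - z" using fin by (intro Min_le)
    moreover have "0 \<le> z" using z by (simp add: Zset_def)
    ultimately show ?thesis using pos by (simp add: Zeps_def)
  qed
  moreover have "?Z \<subseteq> {0..1}" by (auto simp: Zset_def)
  ultimately show ?thesis by (auto simp only: Zset'_def)
qed

lemma wf_assoc_concept:
  assumes "sequent \<Gamma>" "tbox TB" "assoc_concept TB \<Gamma> T"
  shows "wf_concept T"
proof -
  obtain gs zs where gz: "set gs = TB" "set zs = Zset' TB \<Gamma>" "T = big_conj (map (gci_concept zs) gs)"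
    using assms(3) by (auto simp: assoc_concept_def)
  have "wf_concept (gci_concept zs g)" if "g \<in> TB" for g
  proof -
    have "wf_concept (fst g)" "wf_concept (snd g)"
      using that assms(2) by (auto simp: tbox_def)
    moreover have "z \<in> {0..1}" if "z \<in> set zs" for z
      using that Zset'_subset_unit[OF assms(1,2)] gz(2) by blast
    ultimately show ?thesis
      unfolding gci_concept_def by (intro wf_big_disj) auto
  qed
  then show ?thesis unfolding gz(3) by (intro wf_big_conj) (auto simp: gz(1))
qed

lemma assoc_concept_sat_tbox:
  assumes "assoc_concept TB \<Gamma> T" "\<And>x. x \<in> indivs I \<Longrightarrow> ceval I T x \<ge> 1"
  shows "sat_tbox I TB"
proof -
  obtain gs zs where gz: "set gs = TB" "T = big_conj (map (gci_concept zs) gs)"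
    using assms(1) by (auto simp: assoc_concept_def)
  have "ceval I C x \<le> ceval I D x" if "(C, D) \<in> TB" "x \<in> indivs I" for C D x
  proof (rule gci_concept_ge_1[of _ zs])
    show "1 \<le> ceval I (gci_concept zs (C, D)) x"
      using assms(2)[OF that(2)] that(1) gz(1) unfolding gz(2)
      by (elim ceval_big_conj_ge_1) auto
  qed
  then show ?thesis by (auto simp: sat_tbox_def)
qed

section \<open>From the marked tableau graph to a model\<close>

lemma open_sequents_of_marking:
  assumes G: "tableau G \<Gamma> T" and M: "consistent_marking G M" and T: "wf_concept T"
  shows "open_sequents T {P. finite P \<and> wf_assertions P \<and> (\<exists>v \<in> M. lab G v = Seq P)}"
proof
  fix P assume P: "P \<in> {P. finite P \<and> wf_assertions P \<and> (\<exists>v \<in> M. lab G v = Seq P)}"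
  then show "finite P" "wf_assertions P" by auto
  from P obtain v where v: "v \<in> M" "lab G v = Seq P" by blast
  have vG: "v \<in> verts G" using M v by (auto simp: consistent_marking_def marking_def)
  show "\<exists>Q P'. prop_rule P Q \<and> Seq P' \<in> Q \<and>
      P' \<in> {P. finite P \<and> wf_assertions P \<and> (\<exists>v \<in> M. lab G v = Seq P)}"
    if "\<not> saturated (Seq P)"
  proof -
    have or: "or_node G v" using that v by (simp add: and_node_def)
    then obtain Q where Q: "prop_rule P Q" "lab G ` children G v = Q"
      using G vG v unfolding tableau_def by fastforce
    \<comment> \<open>The marking selects the conclusion; for \<open>Conj_upper\<close> this decides
      which conjunct gets the bound.\<close>
    obtain w where w: "w \<in> children G v" "w \<in> M"
      using M v or unfolding consistent_marking_def marking_def by blast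
    then have "lab G w \<noteq> Bot" using M by (simp add: consistent_marking_def)
    then obtain P' where P': "lab G w = Seq P'" by (cases "lab G w") auto
    then have "Seq P' \<in> Q" using Q w by force
    moreover from this have "finite P' \<and> wf_assertions P'"
      using prop_rule_preserves[OF Q(1)] P by blast
    ultimately show ?thesis using Q(1) w P' by blast
  qed
  show "Q \<in> {P. finite P \<and> wf_assertions P \<and> (\<exists>v \<in> M. lab G v = Seq P)}"
    if "saturated (Seq P)" "ex_rule T P Q" for Q
  proof -
    have "and_node G v" using that v by (simp add: and_node_def)
    then have "lab G ` children G v = {Seq Q | P Q. lab G v = Seq P \<and> ex_rule T P Q}"
      and sub: "children G v \<subseteq> M"
      using G vG M v unfolding tableau_def consistent_marking_def marking_def by blast+
    then have "Seq Q \<in> lab G ` children G v" using that(2) v by blast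
    then obtain w where "w \<in> children G v" "lab G w = Seq Q" by force
    then show ?thesis using sub ex_rule_preserves[OF that(2)] P T by blast
  qed
qed

theorem theorem1:
  fixes \<Gamma> :: "('p, 'r) assertion set"
    and TB :: "('p, 'r) gci set"
    and T :: "('p, 'r) concept"
  assumes "sequent \<Gamma>"
    and "tbox TB"
    and "assoc_concept TB \<Gamma> T"
    and "\<exists>G :: ('v, 'p, 'r) tableau_graph. tableau G \<Gamma> T \<and> open_tableau G"
  shows "satisfiable TYPE(nat) TB \<Gamma>"
proof -
  obtain G :: "('v, 'p, 'r) tableau_graph" and M
    where G: "tableau G \<Gamma> T" and M: "consistent_marking G M"
    using assms(4) unfolding open_tableau_def by blast
  have T: "wf_concept T" by (rule wf_assoc_concept[OF assms(1-3)])
  \<comment> \<open>A marking may contain nodes unreachable from the root, whose labels can be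
    infinite or ill-formed, so these are filtered out.\<close>
  define \<L> where "\<L> = {P. finite P \<and> wf_assertions P \<and> (\<exists>v \<in> M. lab G v = Seq P)}"
  interpret open_sequents T \<L>
    unfolding \<L>_def by (rule open_sequents_of_marking[OF G M T])
  have "finite (\<Gamma> \<union> {(T, Ge, 1)})" "wf_assertions (\<Gamma> \<union> {(T, Ge, 1)})"
    using assms(1) T by (auto simp: sequent_def wf_assertions_def)
  moreover have "root_node G \<in> M" "lab G (root_node G) = Seq (\<Gamma> \<union> {(T, Ge, 1)})"
    using G M by (auto simp: tableau_def consistent_marking_def marking_def)
  ultimately have "\<Gamma> \<union> {(T, Ge, 1)} \<in> \<L>" unfolding \<L>_def by blast
  then obtain I :: "nat set" and H x where fam: "hintikka_family T I H"
    and x: "x \<in> I" "\<Gamma> \<union> {(T, Ge, 1)} \<subseteq> H x"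
    and TH: "\<And>y. y \<in> I \<Longrightarrow> (T, Ge, 1) \<in> H y"
    by (rule hintikka_family_exists) auto
  interpret hintikka_family T I H by (rule fam)
  have "sat_tbox model TB"
    using assms(3) by (rule assoc_concept_sat_tbox) (use truth[OF _ TH] in simp)
  moreover have "\<forall>A \<in> \<Gamma>. sat_assertion model x A"
    using truth[OF x(1)] x(2) by auto
  ultimately show ?thesis
    unfolding satisfiable_def using interpretation_ok_model x(1) by (metis indivs_model)
qed

end
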